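(* Let $g:\mathbb{R}^n\to\mathbb{R}$ be Lipschitz continuous with respect to $\|\cdot\|_a$, with decomposition $g(\mathbf{x})=\tilde g(\mathbf{x}^{(1)})+\boldsymbol\beta^T\mathbf{x}^{(2)}$, where $\mathbf{x}=(\mathbf{x}^{(1)},\mathbf{x}^{(2)})$, $\mathbf{x}^{(1)}\in\mathbb{R}^m$, $\mathbf{x}^{(2)}\in\mathbb{R}^{n-m}$, $m\le n$, $\boldsymbol\beta\in\mathbb{R}^{n-m}$, and $\tilde g:\mathbb{R}^m\to\mathbb{R}$ is Lipschitz continuous. If $\mathbf{X}\in\mathcal{L}^p_n$ with $g(\mathbf{X})\in\mathcal{L}^p$, then for any $\epsilon\ge 0$, $$\mathcal{U}_{\|\boldsymbol\beta\|_b\epsilon}(g(\mathbf{X}))\subseteq g\big(\mathcal{U}^n_\epsilon(\mathbf{X})\big),$$ where $\frac1a+\frac1b=1$.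
   Context: Fix $a\ge 1$ and $p\ge 1$ and a non-atomic probability space $(\Omega,\mathcal{B},\mathbb{P})$ with $\mathcal{B}=\mathcal{B}(\mathbb{R}^n)$; all random variables/vectors live on it. $\|\mathbf{x}\|_a=(\sum_i|x_i|^a)^{1/a}$; $b=\infty$ (max norm) when $a=1$. $\mathcal{L}^p_n$ is the space of $n$-dimensional random vectors $\mathbf{X}$ with $\mathbb{E}[\|\mathbf{X}\|_a^p]<\infty$, and $\mathcal{L}^p=\mathcal{L}^p_1$. $F_{\mathbf{X}}$ is the cdf of $\mathbf{X}$. For cdfs $F,G$ on $\mathbb{R}^n$ with finite $p$-th moments, $W^n(F,G)=\inf (\mathbb{E}[\|\mathbf{X}-\mathbf{Y}\|_a^p])^{1/p}$, the infimum over all couplings $(\mathbf{X},\mathbf{Y})$ with $F_{\mathbf{X}}=F$, $F_{\mathbf{Y}}=G$. The Wasserstein uncertainty set is $\mathcal{U}^n_\epsilon(\mathbf{X})=\{\mathbf{Z}\in\mathcal{L}^p_n : W^n(F_{\mathbf{Z}},F_{\mathbf{X}})\le\epsilon\}$, with $\mathcal{U}_\epsilon=\mathcal{U}^1_\epsilon$ for univariate random variables. $g(\mathcal{U}^n_\epsilon(\mathbf{X}))=\{g(\mathbf{Z}):\mathbf{Z}\in\mathcal{U}^n_\epsilon(\mathbf{X})\}$. Conventions on the decomposition: if $g$ has no linear components then $m=n$ and $\tilde g=g$ (so $\|\boldsymbol\beta\|_b=0$); otherwise the smallest possible $m$ is chosen. Standing assumption: $g$ is non-constant.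
   Formalization: The inclusion is proved with random variables identified when they have the same cdf: each V in the left-hand set has the law of g(Z) for some Z in the n-dimensional uncertainty set. Read with almost sure equality it is false (P uniform on [-1,1], X the identity, g(x)=|x|, ε=0). *)

theory Defs
  imports "HOL-Probability.Probability"
begin

definition nonatomic :: "'w measure \<Rightarrow> bool" where
  "nonatomic M \<longleftrightarrow>
     (\<forall>A\<in>sets M. 0 < emeasure M A \<longrightarrow>
        (\<exists>B\<in>sets M. B \<subseteq> A \<and> 0 < emeasure M B \<and> emeasure M B < emeasure M A))"

text \<open>The \<open>\<ell>\<close>-\<open>q\<close> norm on \<open>\<real>\<close> to the power \<open>I\<close> for a finite, possibly empty, index set \<open>I\<close>; the exponent
  ranges over \<open>ennreal\<close>, so that \<open>1 / a + 1 / b = 1\<close> makes sense for \<open>a = 1\<close>, \<open>b = \<infinity>\<close>. The \<open>insert 0\<close>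
  only matters for \<open>I = {}\<close>.\<close>

definition lq_norm :: "ennreal \<Rightarrow> 'i set \<Rightarrow> ('i \<Rightarrow> real) \<Rightarrow> real" where
  "lq_norm q I u =
     (if q = \<infinity> then Max (insert 0 ((\<lambda>i. \<bar>u i\<bar>) ` I))
      else (\<Sum>i\<in>I. \<bar>u i\<bar> powr enn2real q) powr (1 / enn2real q))"

definition vec_norm :: "real \<Rightarrow> real ^ 'n \<Rightarrow> real" where
  "vec_norm a x = lq_norm (ennreal a) UNIV (\<lambda>i. x $ i)"

definition lipschitz_vec :: "real \<Rightarrow> (real ^ 'n \<Rightarrow> real) \<Rightarrow> bool" where
  "lipschitz_vec a g \<longleftrightarrow> (\<exists>L. \<forall>x y. \<bar>g x - g y\<bar> \<le> L * vec_norm a (x - y))"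

text \<open>Splitting \<open>x\<close> into the coordinates in \<open>I\<close> and those outside \<open>I\<close> is splitting \<open>x\<close> into two
  blocks after renumbering the coordinates; both \<open>I = {}\<close> and \<open>I = UNIV\<close> are allowed, which rules out
  separate index types for the blocks. A function on \<open>\<real>\<close> to the power \<open>I\<close> is a function on the
  extensional functions \<open>PiE I (\<lambda>_. UNIV)\<close>. Only the values of \<open>\<beta>\<close> outside \<open>I\<close> matter.\<close>

definition decomposition ::
  "real \<Rightarrow> (real ^ 'n \<Rightarrow> real) \<Rightarrow> 'n set \<Rightarrow> (('n \<Rightarrow> real) \<Rightarrow> real) \<Rightarrow> ('n \<Rightarrow> real) \<Rightarrow> bool" where
  "decomposition a g I gt \<beta> \<longleftrightarrow>
     (\<exists>L. \<forall>u\<in>PiE I (\<lambda>_. UNIV). \<forall>v\<in>PiE I (\<lambda>_. UNIV).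
        \<bar>gt u - gt v\<bar> \<le> L * lq_norm (ennreal a) I (\<lambda>i. u i - v i)) \<and>
     (\<forall>x. g x = gt (restrict (\<lambda>i. x $ i) I) + (\<Sum>i\<in>-I. \<beta> i * x $ i))"

definition minimal_decomposition ::
  "real \<Rightarrow> (real ^ 'n \<Rightarrow> real) \<Rightarrow> 'n set \<Rightarrow> (('n \<Rightarrow> real) \<Rightarrow> real) \<Rightarrow> ('n \<Rightarrow> real) \<Rightarrow> bool" where
  "minimal_decomposition a g I gt \<beta> \<longleftrightarrow>
     decomposition a g I gt \<beta> \<and>
     (\<forall>J gt' \<beta>'. decomposition a g J gt' \<beta>' \<longrightarrow> card I \<le> card J)"

text \<open>The following notions take the norm \<open>N\<close> as a parameter, so that they cover random vectors
  (\<open>N = vec_norm a\<close>) as well as real random variables (\<open>N = abs\<close>). Random vectors are functions on the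
  underlying space, not equivalence classes.\<close>

definition Lp_space ::
  "'w measure \<Rightarrow> ('v::ordered_euclidean_space \<Rightarrow> real) \<Rightarrow> real \<Rightarrow> ('w \<Rightarrow> 'v) set" where
  "Lp_space M N p = {X \<in> borel_measurable M. integrable M (\<lambda>\<omega>. N (X \<omega>) powr p)}"

text \<open>The order on \<open>real ^ 'n\<close> is the componentwise one, so this is the joint cdf.\<close>

definition rv_cdf :: "'w measure \<Rightarrow> ('w \<Rightarrow> 'v::ordered_euclidean_space) \<Rightarrow> 'v \<Rightarrow> real" where
  "rv_cdf M X x = measure M {\<omega> \<in> space M. X \<omega> \<le> x}"

text \<open>Meant for cdfs \<open>F\<close>, \<open>G\<close> of elements of \<open>Lp_space M N p\<close>: then couplings exist and the
  expectations are finite, so neither \<open>Inf\<close> nor the Bochner integral takes a default value.\<close>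

definition wasserstein ::
  "'w measure \<Rightarrow> ('v::ordered_euclidean_space \<Rightarrow> real) \<Rightarrow> real \<Rightarrow> ('v \<Rightarrow> real) \<Rightarrow> ('v \<Rightarrow> real) \<Rightarrow> real" where
  "wasserstein M N p F G =
     Inf {(\<integral>\<omega>. N (X \<omega> - Y \<omega>) powr p \<partial>M) powr (1 / p) | X Y.
            X \<in> borel_measurable M \<and> Y \<in> borel_measurable M \<and> rv_cdf M X = F \<and> rv_cdf M Y = G}"

definition uncertainty_set ::
  "'w measure \<Rightarrow> ('v::ordered_euclidean_space \<Rightarrow> real) \<Rightarrow> real \<Rightarrow> real \<Rightarrow> ('w \<Rightarrow> 'v) \<Rightarrow> ('w \<Rightarrow> 'v) set" where
  "uncertainty_set M N p \<epsilon> X =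
     {Z \<in> Lp_space M N p. wasserstein M N p (rv_cdf M Z) (rv_cdf M X) \<le> \<epsilon>}"

text \<open>Inclusion of sets of random variables that are identified when they have the same cdf. With
  identification only up to almost sure equality, the inclusion of uncertainty sets would fail.
  Let \<open>M\<close> be uniform on \<open>[-1,1]\<close>, \<open>X \<omega> = \<omega>\<close>, \<open>g x = \<bar>x\<bar>\<close>, \<open>\<epsilon> = 0\<close>. Then \<open>Z \<omega> = (\<omega> + 1) / 2\<close> has
  the cdf of \<open>g X\<close>. Suppose \<open>Z = \<bar>Z'\<bar>\<close> almost surely and \<open>Z'\<close> has the cdf of \<open>X\<close>. Then the sign of \<open>Z'\<close> is
  independent of \<open>\<bar>Z'\<bar>\<close> and takes two values with probability 1/2 each; but it is a function
  of \<open>\<omega>\<close>, hence of \<open>Z\<close>, a contradiction.\<close>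

definition subset_in_law ::
  "'w measure \<Rightarrow> ('w \<Rightarrow> 'v::ordered_euclidean_space) set \<Rightarrow> ('w \<Rightarrow> 'v) set \<Rightarrow> bool" where
  "subset_in_law M A B \<longleftrightarrow> rv_cdf M ` A \<subseteq> rv_cdf M ` B"

end

theory Submission
  imports Defs
begin

text \<open>Let \<open>V\<close> lie in the univariate uncertainty set. An optimal coupling of \<open>V\<close> with \<open>g X\<close> is the
  comonotone one, and it can be realised on \<open>M\<close> as \<open>(V', g X')\<close> where \<open>X'\<close> has the law of \<open>X\<close>. If \<open>d\<close>
  is the direction in the linear coordinates that attains equality in Hoelder's inequality with \<open>\<beta>\<close>,
  scaled so that \<open>g (x + c d) = g x + c\<close>, then \<open>Z = X' + (V' - g X') d\<close> satisfies \<open>g Z = V'\<close>, and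
  \<open>Z - X'\<close> has norm \<open>\<bar>V' - g X'\<bar> / B\<close>, where \<open>B\<close> is the dual norm of \<open>\<beta>\<close>.
  If \<open>B = 0\<close>, then \<open>V\<close> has the law of \<open>g X\<close>, because the optimal coupling has cost \<open>0\<close>.\<close>

subsection \<open>Laws on a non-atomic space\<close>

lemma ternary_digit:
  fixes c :: "nat \<Rightarrow> int"
  assumes c: "\<And>k. c k \<in> {0, 1}"
  defines "y \<equiv> (\<Sum>j. real_of_int (c j) / 3 ^ Suc j)"
  shows "c k = \<lfloor>3 ^ Suc k * y\<rfloor> - 3 * \<lfloor>3 ^ k * y\<rfloor>"
proof -
  define t where "t k = (\<Sum>j. real_of_int (c (k + j)) / 3 ^ Suc j)" for k
  define n :: "nat \<Rightarrow> int" where "n = rec_nat 0 (\<lambda>k m. 3 * m + c k)"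
  have n0: "n 0 = 0" and nS: "n (Suc k) = 3 * n k + c k" for k
    by (simp_all add: n_def)
  have geo: "(\<lambda>j. 1 / 3 ^ Suc j :: real) sums (1 / 2)"
    using sums_mult[OF geometric_sums[of "1 / 3 :: real"], of "1 / 3"] by (simp add: power_divide)
  have c01: "0 \<le> c j" "c j \<le> 1" for j
    using c[of j] by auto
  have sm: "summable (\<lambda>j. real_of_int (c (k + j)) / 3 ^ Suc j)" for k
    by (rule summable_comparison_test'[OF sums_summable[OF geo], of 0])
       (use c01 in \<open>auto intro!: divide_right_mono\<close>)
  have t01: "0 \<le> t k" "t k < 1" for k
  proof -
    show "0 \<le> t k"
      unfolding t_def by (rule suminf_nonneg[OF sm]) (use c01 in auto)
    have "t k \<le> (\<Sum>j. 1 / 3 ^ Suc j)"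
      unfolding t_def
      by (rule suminf_le[OF _ sm sums_summable[OF geo]]) (use c01 in \<open>auto intro!: divide_right_mono\<close>)
    then show "t k < 1"
      using sums_unique[OF geo] by simp
  qed
  have tS: "3 * t k = c k + t (Suc k)" for k
  proof -
    have "(\<Sum>j. real_of_int (c (k + Suc j)) / 3 ^ Suc (Suc j)) =
        (\<Sum>j. real_of_int (c (k + j)) / 3 ^ Suc j) - real_of_int (c (k + 0)) / 3 ^ Suc 0"
      by (rule suminf_split_head[OF sm])
    moreover have "(\<Sum>j. real_of_int (c (k + Suc j)) / 3 ^ Suc (Suc j)) = t (Suc k) / 3"
      unfolding t_def using suminf_divide[OF sm, of "Suc k" 3] by (simp add: mult_ac)
    ultimately show ?thesis
      by (simp add: t_def)
  qed
  have exp: "3 ^ k * y = n k + t k" for k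
  proof (induction k)
    case 0
    then show ?case by (simp add: n0 t_def y_def)
  next
    case (Suc k)
    have "3 ^ Suc k * y = 3 * (3 ^ k * y)" by simp
    then show ?case unfolding Suc using tS[of k] by (simp add: nS)
  qed
  have "\<lfloor>3 ^ k * y\<rfloor> = n k" for k
    using exp[of k] t01[of k] by linarith
  from this[of k] this[of "Suc k"] show ?thesis
    using nS[of k] by (simp del: power_Suc)
qed

text \<open>The point \<open>x\<close> is encoded by the ternary expansion of the truth values of \<open>q < x \<bullet> i\<close>, for
  basis vectors \<open>i\<close> and rational \<open>q\<close>.\<close>

lemma borel_embedding_real:
  obtains \<phi> :: "'a::euclidean_space \<Rightarrow> real" and \<psi> :: "real \<Rightarrow> 'a"
  where "\<phi> \<in> borel_measurable borel" "\<psi> \<in> borel_measurable borel" "\<And>x. \<psi> (\<phi> x) = x"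
proof -
  define S where "S = (Basis :: 'a set) \<times> (UNIV :: rat set)"
  have S: "countable S" "S \<noteq> {}"
    using countable_finite[OF finite_Basis] by (auto simp: S_def)
  define e where "e = from_nat_into S"
  define c :: "'a \<Rightarrow> nat \<Rightarrow> int" where
    "c x k = (if real_of_rat (snd (e k)) < x \<bullet> fst (e k) then 1 else 0)" for x k
  define d :: "nat \<Rightarrow> real \<Rightarrow> int" where
    "d k y = \<lfloor>3 ^ Suc k * y\<rfloor> - 3 * \<lfloor>3 ^ k * y\<rfloor>" for k y
  define \<phi> where "\<phi> x = (\<Sum>j. real_of_int (c x j) / 3 ^ Suc j)" for x
  define s where "s i y = (SUP q::rat. if d (to_nat_on S (i, q)) y = 1
                      then ereal (real_of_rat q) else -\<infinity>)" for i y
  define \<psi> where "\<psi> y = (\<Sum>i\<in>Basis. real_of_ereal (s i y) *\<^sub>R i)" for y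
  have [measurable]: "(\<lambda>x. c x k) \<in> borel \<rightarrow>\<^sub>M count_space UNIV" for k
    unfolding c_def by measurable
  have [measurable]: "d k \<in> borel \<rightarrow>\<^sub>M count_space UNIV" for k
    unfolding d_def by measurable
  have "\<phi> \<in> borel_measurable borel"
    unfolding \<phi>_def by measurable
  moreover have "\<psi> \<in> borel_measurable borel"
    unfolding \<psi>_def s_def by measurable
  moreover have "\<psi> (\<phi> x) = x" for x
  proof -
    have "s i (\<phi> x) = ereal (x \<bullet> i)" if "i \<in> Basis" for i
    proof -
      have d: "d (to_nat_on S (i, q)) (\<phi> x) = (if real_of_rat q < x \<bullet> i then 1 else 0)" for q
      proof -
        have "d k (\<phi> x) = c x k" for k
          unfolding d_def \<phi>_def by (rule ternary_digit[symmetric]) (simp add: c_def)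
        moreover have "(i, q) \<in> S"
          using that by (simp add: S_def)
        ultimately show ?thesis
          using S by (simp add: c_def e_def from_nat_into_to_nat_on)
      qed
      show ?thesis
        unfolding s_def d
      proof (rule SUP_eqI)
        fix u assume u: "\<And>q. q \<in> UNIV \<Longrightarrow> (if (if real_of_rat q < x \<bullet> i then 1::int else 0) = 1
                      then ereal (real_of_rat q) else -\<infinity>) \<le> u"
        show "ereal (x \<bullet> i) \<le> u"
        proof (rule ccontr)
          assume "\<not> ereal (x \<bullet> i) \<le> u"
          then have "u < ereal (x \<bullet> i)" by simp
          then obtain r where r: "u < ereal r" "r < x \<bullet> i"
            using ereal_dense2 by force
          obtain q where "r < real_of_rat q" "real_of_rat q < x \<bullet> i"
            using of_rat_dense[OF r(2)] by blast
          then have "ereal (real_of_rat q) \<le> u" "ereal r < ereal (real_of_rat q)"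
            using u[of q] by auto
          then show False using r(1) by order
        qed
      qed auto
    qed
    then show ?thesis
      by (simp add: \<psi>_def euclidean_representation)
  qed
  ultimately show ?thesis
    by (rule that)
qed

context prob_space
begin

definition uniform_rv :: "('a \<Rightarrow> real) \<Rightarrow> bool" where
  "uniform_rv U \<longleftrightarrow> random_variable borel U \<and>
     (\<forall>u\<in>{0..1}. prob {\<omega>\<in>space M. U \<omega> \<le> u} = u)"

lemma uniform_rv_AE:
  assumes "uniform_rv U"
  shows "AE \<omega> in M. 0 < U \<omega> \<and> U \<omega> < 1"
proof -
  have [measurable]: "random_variable borel U"
    and U: "\<And>u. u \<in> {0..1} \<Longrightarrow> prob {\<omega>\<in>space M. U \<omega> \<le> u} = u"
    using assms by (auto simp: uniform_rv_def)
  have "prob {\<omega>\<in>space M. U \<omega> < 1} \<ge> 1"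
  proof (rule field_le_epsilon)
    fix e :: real assume "0 < e"
    define u where "u = max 0 (1 - e)"
    have "u \<in> {0..1}" "1 \<le> u + e" "u < 1"
      using \<open>0 < e\<close> by (auto simp: u_def)
    have "u = prob {\<omega>\<in>space M. U \<omega> \<le> u}"
      using U[OF \<open>u \<in> {0..1}\<close>] by simp
    also have "\<dots> \<le> prob {\<omega>\<in>space M. U \<omega> < 1}"
      using \<open>u < 1\<close> by (intro finite_measure_mono) auto
    finally show "1 \<le> prob {\<omega>\<in>space M. U \<omega> < 1} + e"
      using \<open>1 \<le> u + e\<close> by linarith
  qed
  then have "AE \<omega> in M. U \<omega> < 1"
    by (subst prob_Collect_eq_1[symmetric]) (auto intro: antisym)
  moreover have "AE \<omega> in M. \<not> U \<omega> \<le> 0"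
    by (subst prob_Collect_eq_0[symmetric]) (use U[of 0] in auto)
  ultimately show ?thesis by eventually_elim auto
qed

lemma uniform_rvI:
  assumes [measurable]: "random_variable borel U"
    and le: "\<And>u. 0 < u \<Longrightarrow> u < 1 \<Longrightarrow> prob {\<omega>\<in>space M. U \<omega> < u} \<le> u"
    and ge: "\<And>u. 0 < u \<Longrightarrow> u < 1 \<Longrightarrow> u \<le> prob {\<omega>\<in>space M. U \<omega> \<le> u}"
  shows "uniform_rv U"
  unfolding uniform_rv_def
proof (intro conjI ballI antisym)
  fix u :: real assume u: "u \<in> {0..1}"
  show "prob {\<omega>\<in>space M. U \<omega> \<le> u} \<le> u"
  proof (rule field_le_epsilon)
    fix e :: real assume "0 < e"
    show "prob {\<omega>\<in>space M. U \<omega> \<le> u} \<le> u + e"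
    proof (cases "u + e < 1")
      case True
      have "prob {\<omega>\<in>space M. U \<omega> \<le> u} \<le> prob {\<omega>\<in>space M. U \<omega> < u + e}"
        using \<open>0 < e\<close> by (intro finite_measure_mono) auto
      also have "\<dots> \<le> u + e"
        using True \<open>0 < e\<close> u by (intro le) auto
      finally show ?thesis .
    next
      case False
      then show ?thesis
        using prob_le_1[of "{\<omega>\<in>space M. U \<omega> \<le> u}"] by linarith
    qed
  qed
  show "u \<le> prob {\<omega>\<in>space M. U \<omega> \<le> u}"
  proof (rule field_le_epsilon)
    fix e :: real assume "0 < e"
    show "u \<le> prob {\<omega>\<in>space M. U \<omega> \<le> u} + e"
    proof (cases "0 < u - e / 2")
      case True
      have "u - e / 2 \<le> prob {\<omega>\<in>space M. U \<omega> \<le> u - e / 2}"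
        using True \<open>0 < e\<close> u by (intro ge) auto
      also have "\<dots> \<le> prob {\<omega>\<in>space M. U \<omega> \<le> u}"
        using \<open>0 < e\<close> by (intro finite_measure_mono) auto
      finally show ?thesis using \<open>0 < e\<close> by linarith
    next
      case False
      then show ?thesis
        using measure_nonneg[of M "{\<omega>\<in>space M. U \<omega> \<le> u}"] \<open>0 < e\<close> by linarith
    qed
  qed
qed fact

lemma quantile_function:
  assumes U: "uniform_rv U" and D: "real_distribution D"
  obtains Q :: "real \<Rightarrow> real" where "Q \<in> borel_measurable borel" "mono_on {0<..<1} Q"
    "distr M borel (\<lambda>\<omega>. Q (U \<omega>)) = D"
proof -
  interpret D: cdf_distribution D
    using D by (simp add: cdf_distribution_def)
  define Q where "Q u = (if 0 < u \<and> u < 1 then D.I u else 0)" for u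
  have "(\<lambda>u. indicator {0<..<1} u *\<^sub>R D.I u) \<in> borel_measurable borel"
    using D.measurable_CI by (subst (asm) borel_measurable_restrict_space_iff) auto
  also have "(\<lambda>u. indicator {0<..<1} u *\<^sub>R D.I u) = Q"
    by (auto simp: Q_def)
  finally have [measurable]: "Q \<in> borel_measurable borel" .
  have [measurable]: "random_variable borel U"
    using U by (simp add: uniform_rv_def)
  have "distr M borel (\<lambda>\<omega>. Q (U \<omega>)) = D"
  proof (rule cdf_unique)
    show "real_distribution (distr M borel (\<lambda>\<omega>. Q (U \<omega>)))"
      by (intro real_distribution_distr) measurable
    show "cdf (distr M borel (\<lambda>\<omega>. Q (U \<omega>))) = cdf D"
    proof
      fix x
      have "cdf (distr M borel (\<lambda>\<omega>. Q (U \<omega>))) x = prob {\<omega>\<in>space M. Q (U \<omega>) \<le> x}"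
        by (simp add: cdf_def measure_distr vimage_def Int_def conj_commute)
      also have "\<dots> = prob {\<omega>\<in>space M. U \<omega> \<le> cdf D x}"
      proof (rule finite_measure_eq_AE)
        show "AE \<omega> in M. (\<omega> \<in> {\<omega>\<in>space M. Q (U \<omega>) \<le> x}) = (\<omega> \<in> {\<omega>\<in>space M. U \<omega> \<le> cdf D x})"
          using uniform_rv_AE[OF U]
        proof eventually_elim
          case (elim \<omega>)
          then show ?case
            using D.pseudoinverse[of "U \<omega>" x] by (simp add: Q_def)
        qed
      qed auto
      also have "\<dots> = cdf D x"
        using U D.cdf_nonneg[of x] D.cdf_bounded_prob[of x] by (auto simp: uniform_rv_def)
      finally show "cdf (distr M borel (\<lambda>\<omega>. Q (U \<omega>))) x = cdf D x" .
    qed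
  qed fact
  moreover have "mono_on {0<..<1} Q"
    using D.mono_I by (auto simp: Q_def mono_on_def)
  ultimately show ?thesis
    using that \<open>Q \<in> borel_measurable borel\<close> by blast
qed

text \<open>The randomisation \<open>\<Lambda>\<close> spreads each atom of the law of \<open>Y\<close> over the corresponding jump of the
  cdf of \<open>Y\<close>.\<close>

lemma distributional_transform:
  fixes Y \<Lambda> :: "'a \<Rightarrow> real"
  assumes [measurable]: "random_variable borel Y" "random_variable borel \<Lambda>"
    and \<Lambda>: "\<And>\<omega>. 0 \<le> \<Lambda> \<omega>" "\<And>\<omega>. \<Lambda> \<omega> \<le> 1"
    and ind: "\<And>y l. 0 \<le> l \<Longrightarrow> l \<le> 1 \<Longrightarrow>
      prob {\<omega>\<in>space M. Y \<omega> = y \<and> \<Lambda> \<omega> \<le> l} = prob {\<omega>\<in>space M. Y \<omega> = y} * l"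
  obtains T where "uniform_rv T" "\<And>\<omega> \<omega>'. Y \<omega> < Y \<omega>' \<Longrightarrow> T \<omega> \<le> T \<omega>'"
proof -
  define Gm where "Gm y = prob {\<omega>\<in>space M. Y \<omega> < y}" for y
  define Gp where "Gp y = prob {\<omega>\<in>space M. Y \<omega> \<le> y}" for y
  define T where "T \<omega> = Gm (Y \<omega>) + \<Lambda> \<omega> * (Gp (Y \<omega>) - Gm (Y \<omega>))" for \<omega>
  have le: "Gm y \<le> Gp y" for y
    unfolding Gm_def Gp_def by (intro finite_measure_mono) auto
  have lt: "Gp y \<le> Gm y'" if "y < y'" for y y'
    unfolding Gm_def Gp_def using that by (intro finite_measure_mono) auto
  have "Gm x \<le> Gm y \<and> Gp x \<le> Gp y" if "x \<le> y" for x y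
    using le[of x] le[of y] lt[of x y] that by (cases "x = y") auto
  then have "mono Gm" "mono Gp"
    by (auto simp: mono_def)
  then have [measurable]: "Gm \<in> borel_measurable borel" "Gp \<in> borel_measurable borel"
    by (auto intro: borel_measurable_mono)
  have [measurable]: "random_variable borel T"
    unfolding T_def by measurable
  have atom: "prob {\<omega>\<in>space M. Y \<omega> = y} = Gp y - Gm y" for y
  proof -
    have "Gp y = prob ({\<omega>\<in>space M. Y \<omega> < y} \<union> {\<omega>\<in>space M. Y \<omega> = y})"
      unfolding Gp_def by (rule arg_cong[where f = prob]) auto
    also have "\<dots> = Gm y + prob {\<omega>\<in>space M. Y \<omega> = y}"
      unfolding Gm_def by (rule finite_measure_Union) auto
    finally show ?thesis by simp
  qed
  have T_ge: "Gm (Y \<omega>) \<le> T \<omega>" for \<omega>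
    using \<Lambda>[of \<omega>] le[of "Y \<omega>"] by (simp add: T_def)
  have T_le: "T \<omega> \<le> Gp (Y \<omega>)" for \<omega>
    using \<Lambda>[of \<omega>] le[of "Y \<omega>"] mult_right_mono[of "\<Lambda> \<omega>" 1 "Gp (Y \<omega>) - Gm (Y \<omega>)"]
    by (simp add: T_def)
  interpret D: cdf_distribution "distr M borel Y"
    unfolding cdf_distribution_def by (rule real_distribution_distr) measurable
  have cdf: "D.C y = Gp y" for y
    by (simp add: cdf_def measure_distr Gp_def vimage_def Int_def conj_commute)
  have main: "prob {\<omega>\<in>space M. T \<omega> < u} \<le> u \<and> u \<le> prob {\<omega>\<in>space M. T \<omega> \<le> u}"
    if u: "0 < u" "u < 1" for u
  proof -
    define y where "y = D.I u"
    have up: "u \<le> Gp y"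
      using D.pseudoinverse[OF u, of y] by (simp add: y_def cdf)
    have "Gm y \<le> u"
    proof (rule tendsto_upperbound)
      show "(D.C \<longlongrightarrow> Gm y) (at_left y)"
        using D.cdf_at_left[of y]
        by (simp add: measure_distr Gm_def vimage_def Int_def conj_commute)
      have "D.C x \<le> u" if "x < y" for x
        using D.pseudoinverse[OF u, of x] that by (auto simp: y_def)
      then show "\<forall>\<^sub>F x in at_left y. D.C x \<le> u"
        by (auto simp: eventually_at_filter)
    qed simp
    define l where "l = (u - Gm y) / (Gp y - Gm y)"
    have l: "0 \<le> l" "l \<le> 1"
      using up \<open>Gm y \<le> u\<close> by (auto simp: l_def divide_le_eq_1)
    let ?A = "{\<omega>\<in>space M. Y \<omega> < y} \<union> {\<omega>\<in>space M. Y \<omega> = y \<and> \<Lambda> \<omega> \<le> l}"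
    have A: "prob ?A = Gm y + (Gp y - Gm y) * l"
      unfolding atom[symmetric] ind[OF l, symmetric] by (subst Gm_def, rule finite_measure_Union) auto
    also have "\<dots> = u"
      using up \<open>Gm y \<le> u\<close> by (auto simp: l_def)
    finally have A: "prob ?A = u" .
    have "prob ?A \<le> prob {\<omega>\<in>space M. T \<omega> \<le> u}"
    proof (rule finite_measure_mono)
      have "T \<omega> \<le> u" if "Y \<omega> < y" for \<omega>
        using T_le[of \<omega>] lt[OF that] \<open>Gm y \<le> u\<close> by linarith
      moreover have "T \<omega> \<le> u" if "Y \<omega> = y" "\<Lambda> \<omega> \<le> l" for \<omega>
      proof (cases "Gp y = Gm y")
        case False
        then have "0 < Gp y - Gm y" using le[of y] by simp
        then show ?thesis
          using that by (simp add: T_def l_def pos_le_divide_eq)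
      qed (use that T_le[of \<omega>] \<open>Gm y \<le> u\<close> in auto)
      ultimately show "?A \<subseteq> {\<omega>\<in>space M. T \<omega> \<le> u}" by auto
    qed measurable
    moreover have "prob {\<omega>\<in>space M. T \<omega> < u} \<le> u"
    proof (cases "Gp y = Gm y")
      case True
      have "prob {\<omega>\<in>space M. T \<omega> < u} \<le> Gp y"
        unfolding Gp_def
      proof (rule finite_measure_mono)
        have "Y \<omega> \<le> y" if "T \<omega> < u" for \<omega>
          using T_ge[of \<omega>] lt[of y "Y \<omega>"] up that by force
        then show "{\<omega>\<in>space M. T \<omega> < u} \<subseteq> {\<omega>\<in>space M. Y \<omega> \<le> y}" by auto
      qed measurable
      then show ?thesis using True \<open>Gm y \<le> u\<close> by simp
    next
      case False
      then have pos: "0 < Gp y - Gm y" using le[of y] by simp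
      have "prob {\<omega>\<in>space M. T \<omega> < u} \<le> prob ?A"
      proof (rule finite_measure_mono)
        have "Y \<omega> < y \<or> Y \<omega> = y \<and> \<Lambda> \<omega> \<le> l" if "T \<omega> < u" for \<omega>
        proof (rule ccontr)
          assume "\<not> (Y \<omega> < y \<or> Y \<omega> = y \<and> \<Lambda> \<omega> \<le> l)"
          then consider "y < Y \<omega>" | "Y \<omega> = y" "l < \<Lambda> \<omega>" by force
          then show False
          proof cases
            case 1
            then show ?thesis using T_ge[of \<omega>] lt[of y "Y \<omega>"] up that by linarith
          next
            case 2
            then have "u < T \<omega>"
              using pos by (simp add: T_def l_def pos_divide_less_eq)
            then show ?thesis using that by simp
          qed
        qed
        then show "{\<omega>\<in>space M. T \<omega> < u} \<subseteq> ?A" by auto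
      qed measurable
      then show ?thesis using A by simp
    qed
    ultimately show ?thesis using A by simp
  qed
  have "uniform_rv T"
    by (rule uniform_rvI) (use main in auto)
  moreover have "T \<omega> \<le> T \<omega>'" if "Y \<omega> < Y \<omega>'" for \<omega> \<omega>'
    using T_le[of \<omega>] T_ge[of \<omega>'] lt[OF that] by linarith
  ultimately show ?thesis
    by (rule that)
qed

end

lemma nonatomic_measure_singleton:
  assumes "nonatomic M" "{x} \<in> sets M"
  shows "emeasure M {x} = 0"
proof (rule ccontr)
  assume "emeasure M {x} \<noteq> 0"
  then have "0 < emeasure M {x}" by (simp add: zero_less_iff_neq_zero)
  then obtain B where B: "B \<subseteq> {x}" "0 < emeasure M B" "emeasure M B < emeasure M {x}"
    using assms unfolding nonatomic_def by blast
  from B(1) have "B = {} \<or> B = {x}" by auto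
  then show False using B by auto
qed

lemma nonatomic_uniform_rv:
  fixes M :: "'a::euclidean_space measure"
  assumes "prob_space M" and sets [measurable_cong]: "sets M = sets borel" and "nonatomic M"
  obtains U where "prob_space.uniform_rv M U"
proof -
  interpret prob_space M by fact
  obtain \<phi> :: "'a \<Rightarrow> real" and \<psi> where \<phi>: "\<phi> \<in> borel_measurable borel"
    "\<psi> \<in> borel_measurable borel" "\<And>x. \<psi> (\<phi> x) = x"
    by (rule borel_embedding_real) (rule that)
  note [measurable] = \<phi>(1)
  have atom: "prob {\<omega>\<in>space M. \<phi> \<omega> = y} = 0" for y
  proof -
    have "{\<omega>\<in>space M. \<phi> \<omega> = y} \<subseteq> {\<psi> y}"
      using \<phi>(3) by force
    then have "prob {\<omega>\<in>space M. \<phi> \<omega> = y} \<le> prob {\<psi> y}"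
      by (intro finite_measure_mono) (auto simp: sets)
    also have "\<dots> = 0"
      using nonatomic_measure_singleton[OF \<open>nonatomic M\<close>] by (simp add: sets measure_def)
    finally show ?thesis using measure_nonneg[of M] by (simp add: antisym)
  qed
  obtain T where "uniform_rv T"
    by (rule distributional_transform[of \<phi> "\<lambda>_. 0"]) (use atom in auto)
  then show ?thesis by (rule that)
qed

lemma nonatomic_realise_law:
  fixes M :: "'a::euclidean_space measure" and N :: "'b::euclidean_space measure"
  assumes M: "prob_space M" "sets M = sets borel" "nonatomic M"
    and N: "prob_space N" and N_sets [measurable_cong]: "sets N = sets borel"
  obtains W where "W \<in> borel_measurable M" "distr M borel W = N"
proof -
  interpret prob_space M by fact
  interpret N: prob_space N by fact
  obtain U where U: "uniform_rv U"
    using nonatomic_uniform_rv[OF M] .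
  then have [measurable]: "random_variable borel U" by (simp add: uniform_rv_def)
  obtain \<phi> :: "'b \<Rightarrow> real" and \<psi> where \<phi>: "\<phi> \<in> borel_measurable borel"
    "\<psi> \<in> borel_measurable borel" "\<And>x. \<psi> (\<phi> x) = x"
    by (rule borel_embedding_real) (rule that)
  note [measurable] = \<phi>(1,2)
  have "real_distribution (distr N borel \<phi>)"
    by (rule N.real_distribution_distr) measurable
  then obtain Q where Q: "Q \<in> borel_measurable borel"
      "distr M borel (\<lambda>\<omega>. Q (U \<omega>)) = distr N borel \<phi>"
    using quantile_function[OF U] by metis
  note [measurable] = Q(1)
  have "distr M borel (\<lambda>\<omega>. \<psi> (Q (U \<omega>))) = distr (distr M borel (\<lambda>\<omega>. Q (U \<omega>))) borel \<psi>"
    by (subst distr_distr) (auto simp: comp_def)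
  also have "\<dots> = N"
    unfolding Q(2) by (subst distr_distr) (auto simp: comp_def \<phi>(3) N_sets distr_id2)
  finally show ?thesis
    by (rule that[rotated]) measurable
qed

subsection \<open>Optimality of comonotone couplings\<close>

lemma (in prob_space) comonotone_prob_le:
  fixes V Y :: "'a \<Rightarrow> real" and V' Y' :: "'a \<Rightarrow> real"
  assumes [measurable]: "random_variable borel V" "random_variable borel Y"
      "random_variable borel V'" "random_variable borel Y'"
    and V: "distr M borel V' = distr M borel V" and Y: "distr M borel Y' = distr M borel Y"
    and E: "E \<in> sets M" "prob E = 1"
    and mono: "\<And>\<omega> \<omega>'. \<omega> \<in> E \<Longrightarrow> \<omega>' \<in> E \<Longrightarrow> Y \<omega> < Y \<omega>' \<Longrightarrow> V \<omega> \<le> V \<omega>'"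
  shows "prob {\<omega>\<in>space M. Y \<omega> \<le> s \<and> t \<le> V \<omega>} \<le> prob {\<omega>\<in>space M. Y' \<omega> \<le> s \<and> t \<le> V' \<omega>}"
proof -
  note [measurable] = E(1)
  have AE_E: "AE \<omega> in M. \<omega> \<in> E"
    using E by (simp add: prob_eq_1)
  let ?A = "{\<omega>\<in>space M. Y \<omega> \<le> s}" and ?B = "{\<omega>\<in>space M. V \<omega> < t}"
  let ?A' = "{\<omega>\<in>space M. Y' \<omega> \<le> s}" and ?B' = "{\<omega>\<in>space M. V' \<omega> < t}"
  have A': "prob ?A' = prob ?A"
    using arg_cong[OF Y, of "\<lambda>N. measure N {..s}"]
    by (simp add: measure_distr vimage_def Int_def conj_commute)
  have B': "prob ?B' = prob ?B"
    using arg_cong[OF V, of "\<lambda>N. measure N {..<t}"]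
    by (simp add: measure_distr vimage_def Int_def conj_commute)
  have "{\<omega>\<in>space M. Y \<omega> \<le> s \<and> t \<le> V \<omega>} \<inter> E = {} \<or> ?B \<inter> E \<subseteq> ?A"
    using mono sets.sets_into_space[OF E(1)] by force
  then show ?thesis
  proof
    assume *: "{\<omega>\<in>space M. Y \<omega> \<le> s \<and> t \<le> V \<omega>} \<inter> E = {}"
    have "prob {\<omega>\<in>space M. Y \<omega> \<le> s \<and> t \<le> V \<omega>} = prob {}"
      by (rule finite_measure_eq_AE) (use AE_E * sets.sets_into_space[OF E(1)] in \<open>auto elim!: eventually_mono\<close>)
    then show ?thesis by simp
  next
    assume *: "?B \<inter> E \<subseteq> ?A"
    have "{\<omega>\<in>space M. Y \<omega> \<le> s \<and> t \<le> V \<omega>} = ?A - ?A \<inter> ?B" by auto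
    then have "prob {\<omega>\<in>space M. Y \<omega> \<le> s \<and> t \<le> V \<omega>} = prob ?A - prob (?A \<inter> ?B)"
      by (simp add: finite_measure_Diff)
    also have "prob (?A \<inter> ?B) = prob ?B"
      by (rule finite_measure_eq_AE) (use AE_E * sets.sets_into_space[OF E(1)] in \<open>auto elim!: eventually_mono\<close>)
    also have "prob ?A - prob ?B = prob ?A' - prob ?B'"
      by (simp add: A' B')
    also have "\<dots> \<le> prob ?A' - prob (?A' \<inter> ?B')"
      using finite_measure_mono[of "?A' \<inter> ?B'" ?B'] by auto
    also have "\<dots> = prob (?A' - ?A' \<inter> ?B')"
      by (simp add: finite_measure_Diff)
    also have "?A' - ?A' \<inter> ?B' = {\<omega>\<in>space M. Y' \<omega> \<le> s \<and> t \<le> V' \<omega>}" by auto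
    finally show ?thesis .
  qed
qed

lemma (in prob_space) nn_integral_excess:
  fixes V Y :: "'a \<Rightarrow> real"
  assumes [measurable]: "random_variable borel V" "random_variable borel Y"
  shows "(\<integral>\<^sup>+\<omega>. ennreal (V \<omega> - Y \<omega> - r) \<partial>M) =
    (\<integral>\<^sup>+s. ennreal (prob {\<omega>\<in>space M. Y \<omega> \<le> s \<and> s + r \<le> V \<omega>}) \<partial>lborel)"
proof -
  interpret pair_sigma_finite M lborel ..
  have "ennreal (V \<omega> - Y \<omega> - r) =
      (\<integral>\<^sup>+s. (if Y \<omega> \<le> s \<and> s + r \<le> V \<omega> then 1 else 0) \<partial>lborel)" for \<omega>
  proof -
    have "ennreal (V \<omega> - Y \<omega> - r) = (\<integral>\<^sup>+s. indicator {Y \<omega>..V \<omega> - r} s \<partial>lborel)"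
      by (cases "Y \<omega> \<le> V \<omega> - r") (auto simp: ennreal_neg diff_diff_eq add.commute)
    also have "\<dots> = (\<integral>\<^sup>+s. (if Y \<omega> \<le> s \<and> s + r \<le> V \<omega> then 1 else 0) \<partial>lborel)"
      by (intro nn_integral_cong) (auto simp: indicator_def)
    finally show ?thesis .
  qed
  then have "(\<integral>\<^sup>+\<omega>. ennreal (V \<omega> - Y \<omega> - r) \<partial>M) =
      (\<integral>\<^sup>+\<omega>. (\<integral>\<^sup>+s. (if Y \<omega> \<le> s \<and> s + r \<le> V \<omega> then 1 else 0) \<partial>lborel) \<partial>M)"
    by simp
  also have "\<dots> = (\<integral>\<^sup>+s. (\<integral>\<^sup>+\<omega>. (if Y \<omega> \<le> s \<and> s + r \<le> V \<omega> then 1 else 0) \<partial>M) \<partial>lborel)"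
    by (subst Fubini') auto
  also have "\<dots> = (\<integral>\<^sup>+s. (\<integral>\<^sup>+\<omega>. indicator {\<omega>\<in>space M. Y \<omega> \<le> s \<and> s + r \<le> V \<omega>} \<omega> \<partial>M) \<partial>lborel)"
    by (intro nn_integral_cong) (auto simp: indicator_def)
  also have "\<dots> = (\<integral>\<^sup>+s. ennreal (prob {\<omega>\<in>space M. Y \<omega> \<le> s \<and> s + r \<le> V \<omega>}) \<partial>lborel)"
    by (simp add: emeasure_eq_measure)
  finally show ?thesis .
qed

lemma ennreal_abs_excess:
  fixes x r :: real
  assumes "0 \<le> r"
  shows "ennreal (\<bar>x\<bar> - r) = ennreal (x - r) + ennreal (- x - r)"
  using assms by (cases "0 \<le> x") (auto simp: ennreal_neg)

lemma nn_integral_excess_powr: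
  fixes p u :: real
  assumes "1 < p" "0 \<le> u"
  shows "(\<integral>\<^sup>+r. ennreal (u - r) * ennreal (indicator {0..} r * (p * (p - 1) * r powr (p - 2))) \<partial>lborel) =
    ennreal (u powr p)"
proof -
  define F where "F r = p * u * r powr (p - 1) - (p - 1) * r powr p" for r
  define f where "f r = (u - r) * (p * (p - 1) * r powr (p - 2))" for r
  have "(f has_integral (F u - F 0)) {0..u}"
  proof (rule fundamental_theorem_of_calculus_interior)
    show "continuous_on {0..u} F"
      unfolding F_def using assms by (intro continuous_intros continuous_on_powr') auto
    fix r assume r: "r \<in> {0<..<u}"
    have e: "r powr (p - 1) = r * r powr (p - 2)"
      using r powr_add[of r 1 "p - 2"] by (simp add: powr_one)
    have "((\<lambda>r. r powr q) has_real_derivative q * r powr (q - 1)) (at r)" for q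
      using r by (intro has_real_derivative_powr) auto
    from DERIV_diff[OF DERIV_cmult[OF this[of "p - 1"], of "p * u"] DERIV_cmult[OF this[of p], of "p - 1"]]
    have "(F has_real_derivative p * u * ((p - 1) * r powr (p - 2)) - (p - 1) * (p * r powr (p - 1))) (at r)"
      by (simp add: F_def[abs_def])
    moreover have "p * u * ((p - 1) * r powr (p - 2)) - (p - 1) * (p * r powr (p - 1)) = f r"
      unfolding e f_def by (simp add: algebra_simps)
    ultimately show "(F has_vector_derivative f r) (at r)"
      by (simp add: has_real_derivative_iff_has_vector_derivative)
  qed (use assms in auto)
  moreover have "F u - F 0 = u powr p"
  proof -
    have "u * u powr (p - 1) = u powr p"
      using assms powr_add[of u 1 "p - 1"] by (cases "u = 0") (auto simp: powr_one)
    then show ?thesis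
      using assms by (simp add: F_def mult.assoc) (simp add: algebra_simps)
  qed
  ultimately have "((\<lambda>r. indicator {0..u} r * f r) has_integral (u powr p)) {0..u}"
    by (auto intro: has_integral_eq[rotated])
  then have "(\<integral>\<^sup>+r. ennreal (indicator {0..u} r * (indicator {0..u} r * f r)) \<partial>lborel) = ennreal (u powr p)"
    using assms
    by (intro nn_integral_has_integral_lebesgue) (auto simp: f_def indicator_def)
  also have "(\<integral>\<^sup>+r. ennreal (indicator {0..u} r * (indicator {0..u} r * f r)) \<partial>lborel) =
    (\<integral>\<^sup>+r. ennreal (u - r) * ennreal (indicator {0..} r * (p * (p - 1) * r powr (p - 2))) \<partial>lborel)"
    using assms
    by (intro nn_integral_cong) (auto simp: f_def indicator_def ennreal_mult[symmetric] ennreal_neg)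
  finally show ?thesis .
qed

text \<open>It suffices to compare the costs \<open>max 0 (\<bar>x - y\<bar> - r)\<close> for \<open>r \<ge> 0\<close>, of which \<open>\<bar>x - y\<bar> powr p\<close> is a
  mixture.\<close>

lemma (in prob_space) comonotone_optimal:
  fixes V Y V' Y' :: "'a \<Rightarrow> real"
  assumes meas [measurable]: "random_variable borel V" "random_variable borel Y"
      "random_variable borel V'" "random_variable borel Y'"
    and V: "distr M borel V' = distr M borel V" and Y: "distr M borel Y' = distr M borel Y"
    and E: "E \<in> sets M" "prob E = 1"
    and mono: "\<And>\<omega> \<omega>'. \<omega> \<in> E \<Longrightarrow> \<omega>' \<in> E \<Longrightarrow> Y \<omega> < Y \<omega>' \<Longrightarrow> V \<omega> \<le> V \<omega>'"
    and "1 \<le> p"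
  shows "(\<integral>\<^sup>+\<omega>. ennreal (\<bar>V \<omega> - Y \<omega>\<bar> powr p) \<partial>M) \<le> (\<integral>\<^sup>+\<omega>. ennreal (\<bar>V' \<omega> - Y' \<omega>\<bar> powr p) \<partial>M)"
proof -
  have mono': "Y \<omega> \<le> Y \<omega>'" if "\<omega> \<in> E" "\<omega>' \<in> E" "V \<omega> < V \<omega>'" for \<omega> \<omega>'
    using mono[of \<omega>' \<omega>] that by force
  have exc: "(\<integral>\<^sup>+\<omega>. ennreal (\<bar>V \<omega> - Y \<omega>\<bar> - r) \<partial>M) \<le> (\<integral>\<^sup>+\<omega>. ennreal (\<bar>V' \<omega> - Y' \<omega>\<bar> - r) \<partial>M)"
    if "0 \<le> r" for r
  proof -
    have "(\<integral>\<^sup>+\<omega>. ennreal (V \<omega> - Y \<omega> - r) \<partial>M) \<le> (\<integral>\<^sup>+\<omega>. ennreal (V' \<omega> - Y' \<omega> - r) \<partial>M)"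
      unfolding nn_integral_excess[OF meas(1,2)] nn_integral_excess[OF meas(3,4)]
      by (intro nn_integral_mono ennreal_leI comonotone_prob_le[OF meas V Y E mono])
    moreover have "(\<integral>\<^sup>+\<omega>. ennreal (Y \<omega> - V \<omega> - r) \<partial>M) \<le> (\<integral>\<^sup>+\<omega>. ennreal (Y' \<omega> - V' \<omega> - r) \<partial>M)"
      unfolding nn_integral_excess[OF meas(2,1)] nn_integral_excess[OF meas(4,3)]
      by (intro nn_integral_mono ennreal_leI
          comonotone_prob_le[OF meas(2,1,4,3) Y V E mono'])
    ultimately show ?thesis
      by (simp add: ennreal_abs_excess[OF that] nn_integral_add add_mono)
  qed
  show ?thesis
  proof (cases "p = 1")
    case True
    then show ?thesis
      using exc[of 0] by (simp add: powr_one)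
  next
    case False
    with \<open>1 \<le> p\<close> have "1 < p" by simp
    interpret pair_sigma_finite M lborel ..
    define w where "w r = ennreal (indicator {0..} r * (p * (p - 1) * r powr (p - 2)))" for r
    have [measurable]: "w \<in> borel_measurable borel"
      unfolding w_def by measurable
    have eq: "(\<integral>\<^sup>+\<omega>. ennreal (\<bar>A \<omega> - B \<omega>\<bar> powr p) \<partial>M) =
        (\<integral>\<^sup>+r. (\<integral>\<^sup>+\<omega>. ennreal (\<bar>A \<omega> - B \<omega>\<bar> - r) \<partial>M) * w r \<partial>lborel)"
      if [measurable]: "random_variable borel A" "random_variable borel B" for A B
    proof -
      have "(\<integral>\<^sup>+\<omega>. ennreal (\<bar>A \<omega> - B \<omega>\<bar> powr p) \<partial>M) =
        (\<integral>\<^sup>+\<omega>. (\<integral>\<^sup>+r. ennreal (\<bar>A \<omega> - B \<omega>\<bar> - r) * w r \<partial>lborel) \<partial>M)"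
        unfolding w_def using \<open>1 < p\<close> by (subst nn_integral_excess_powr) auto
      also have "\<dots> = (\<integral>\<^sup>+r. (\<integral>\<^sup>+\<omega>. ennreal (\<bar>A \<omega> - B \<omega>\<bar> - r) * w r \<partial>M) \<partial>lborel)"
        by (subst Fubini') auto
      finally show ?thesis
        by (simp add: nn_integral_multc)
    qed
    show ?thesis
      unfolding eq[OF meas(1,2)] eq[OF meas(3,4)]
    proof (rule nn_integral_mono)
      fix r
      show "(\<integral>\<^sup>+\<omega>. ennreal (\<bar>V \<omega> - Y \<omega>\<bar> - r) \<partial>M) * w r \<le>
          (\<integral>\<^sup>+\<omega>. ennreal (\<bar>V' \<omega> - Y' \<omega>\<bar> - r) \<partial>M) * w r"
        using exc[of r] by (cases "0 \<le> r") (auto intro: mult_right_mono simp: w_def)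
    qed
  qed
qed

subsection \<open>Norms and moments\<close>

lemma dual_direction:
  fixes \<beta> :: "'i \<Rightarrow> real"
  assumes a: "1 \<le> a" and ab: "1 / ennreal a + 1 / b = 1" and J: "finite J"
    and pos: "0 < lq_norm b J \<beta>"
  obtains d where "\<And>i. i \<notin> J \<Longrightarrow> d i = 0" "(\<Sum>i\<in>J. \<beta> i * d i) = 1"
    "(\<Sum>i\<in>J. \<bar>d i\<bar> powr a) powr (1 / a) = 1 / lq_norm b J \<beta>"
proof (cases "a = 1")
  case True
  then have "1 / b = 0"
    using ab by (simp add: ennreal_add_left_cancel[of 1 "1 / b" 0, simplified])
  then have "b = \<infinity>"
    by (simp add: ennreal_divide_eq_0_iff)
  then have B: "lq_norm b J \<beta> = Max (insert 0 ((\<lambda>i. \<bar>\<beta> i\<bar>) ` J))"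
    by (simp add: lq_norm_def)
  then have "lq_norm b J \<beta> \<in> insert 0 ((\<lambda>i. \<bar>\<beta> i\<bar>) ` J)"
    unfolding B using J by (intro Max_in) auto
  then obtain j where j: "j \<in> J" "lq_norm b J \<beta> = \<bar>\<beta> j\<bar>"
    using pos by auto
  define d where "d i = (if i = j then 1 / \<beta> j else 0)" for i
  have "(\<Sum>i\<in>J. \<beta> i * d i) = (\<Sum>i\<in>J. if i = j then 1 else 0)"
    using j pos by (intro sum.cong) (auto simp: d_def)
  moreover have "(\<Sum>i\<in>J. \<bar>d i\<bar> powr a) = (\<Sum>i\<in>J. if i = j then 1 / \<bar>\<beta> j\<bar> else 0)"
    using True by (intro sum.cong) (auto simp: d_def powr_one)
  ultimately show ?thesis
    using j J True by (intro that[of d]) (auto simp: d_def)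
next
  case False
  with a have a1: "1 < a" by simp
  have inv_a: "1 / ennreal a = ennreal (1 / a)"
    using a divide_ennreal[of 1 a] by simp
  obtain r where r: "0 \<le> r" "b = ennreal r"
  proof (cases b)
    case top
    then have "ennreal (1 / a) = ennreal 1"
      using ab inv_a by simp
    then have "1 / a = 1"
      using a1 by (subst (asm) ennreal_inj) auto
    then show ?thesis using a1 by simp
  qed (use that in auto)
  have "r \<noteq> 0"
    using ab r by (auto simp: ennreal_divide_zero)
  with r have r0: "0 < r" by simp
  have "ennreal (1 / a + 1 / r) = ennreal 1"
    using ab inv_a r divide_ennreal[of 1 r] r0 a1 by (simp add: ennreal_plus)
  then have ar: "1 / a + 1 / r = 1"
    using r0 a1 by (subst (asm) ennreal_inj) auto
  then have ar': "(r - 1) * a = r"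
    using r0 a1 by (simp add: field_simps)
  define S where "S = (\<Sum>i\<in>J. \<bar>\<beta> i\<bar> powr r)"
  have B: "lq_norm b J \<beta> = S powr (1 / r)"
    using r by (simp add: lq_norm_def S_def)
  have S: "0 < S"
  proof -
    have "0 \<le> S" unfolding S_def by (intro sum_nonneg) auto
    moreover have "S \<noteq> 0" using pos B by auto
    ultimately show ?thesis by simp
  qed
  define d where "d i = (if i \<in> J then sgn (\<beta> i) * \<bar>\<beta> i\<bar> powr (r - 1) / S else 0)" for i
  have "(\<Sum>i\<in>J. \<beta> i * d i) = (\<Sum>i\<in>J. \<bar>\<beta> i\<bar> powr r / S)"
  proof (rule sum.cong)
    fix i assume i: "i \<in> J"
    have "\<beta> i * (sgn (\<beta> i) * \<bar>\<beta> i\<bar> powr (r - 1)) = \<bar>\<beta> i\<bar> powr 1 * \<bar>\<beta> i\<bar> powr (r - 1)"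
      by (simp add: mult.assoc[symmetric] abs_sgn[symmetric] powr_one)
    also have "\<dots> = \<bar>\<beta> i\<bar> powr r"
      by (subst powr_add[symmetric]) simp
    finally show "\<beta> i * d i = \<bar>\<beta> i\<bar> powr r / S"
      using i by (simp add: d_def)
  qed simp
  then have 1: "(\<Sum>i\<in>J. \<beta> i * d i) = 1"
    using S by (simp add: sum_divide_distrib[symmetric] S_def[symmetric])
  have "(\<Sum>i\<in>J. \<bar>d i\<bar> powr a) = (\<Sum>i\<in>J. \<bar>\<beta> i\<bar> powr r / S powr a)"
  proof (rule sum.cong)
    fix i assume i: "i \<in> J"
    show "\<bar>d i\<bar> powr a = \<bar>\<beta> i\<bar> powr r / S powr a"
    proof (cases "\<beta> i = 0")
      case False
      then show ?thesis
        using i S by (simp add: d_def abs_mult powr_divide powr_powr ar')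
    qed (use i in \<open>simp add: d_def\<close>)
  qed simp
  also have "\<dots> = S powr (1 - a)"
    using S by (simp add: sum_divide_distrib[symmetric] S_def[symmetric] powr_diff powr_one)
  finally have "(\<Sum>i\<in>J. \<bar>d i\<bar> powr a) powr (1 / a) = S powr ((1 - a) / a)"
    by (simp add: powr_powr)
  also have "(1 - a) / a = - (1 / r)"
    using ar a1 by (simp add: diff_divide_distrib)
  also have "S powr (- (1 / r)) = 1 / lq_norm b J \<beta>"
    by (simp add: B powr_minus_divide)
  finally show ?thesis
    using 1 by (intro that[of d]) (auto simp: d_def)
qed

lemma vec_norm_eq:
  assumes "0 < a"
  shows "vec_norm a x = (\<Sum>i\<in>UNIV. \<bar>x $ i\<bar> powr a) powr (1 / a)"
  using assms by (simp add: vec_norm_def lq_norm_def)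

lemma vec_norm_nonneg:
  assumes "0 < a"
  shows "0 \<le> vec_norm a x"
  using assms by (simp add: vec_norm_eq)

lemma vec_norm_scaleR:
  assumes "0 < a"
  shows "vec_norm a (c *\<^sub>R x) = \<bar>c\<bar> * vec_norm a x"
proof -
  have "(\<Sum>i\<in>UNIV. \<bar>(c *\<^sub>R x) $ i\<bar> powr a) = \<bar>c\<bar> powr a * (\<Sum>i\<in>UNIV. \<bar>x $ i\<bar> powr a)"
    by (simp add: abs_mult powr_mult sum_distrib_left)
  then show ?thesis
    using assms by (simp add: vec_norm_eq powr_mult sum_nonneg powr_powr)
qed

lemma vec_norm_le_norm:
  fixes x :: "real ^ 'n"
  assumes "0 < a"
  shows "vec_norm a x \<le> real CARD('n) powr (1 / a) * norm x"
proof -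
  have "(\<Sum>i\<in>UNIV. \<bar>x $ i\<bar> powr a) \<le> (\<Sum>i\<in>(UNIV::'n set). norm x powr a)"
    using assms component_le_norm_cart[of x] by (intro sum_mono powr_mono2) auto
  then have "vec_norm a x \<le> (real CARD('n) * norm x powr a) powr (1 / a)"
    using assms by (simp add: vec_norm_eq powr_mono2 sum_nonneg)
  also have "\<dots> = real CARD('n) powr (1 / a) * norm x"
    using assms by (simp add: powr_mult powr_powr)
  finally show ?thesis .
qed

lemma norm_le_vec_norm:
  fixes x :: "real ^ 'n"
  assumes "0 < a"
  shows "norm x \<le> real CARD('n) * vec_norm a x"
proof -
  have "\<bar>x $ i\<bar> \<le> vec_norm a x" for i
  proof -
    have "\<bar>x $ i\<bar> powr a \<le> (\<Sum>i\<in>UNIV. \<bar>x $ i\<bar> powr a)"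
      by (intro member_le_sum) auto
    then have "(\<bar>x $ i\<bar> powr a) powr (1 / a) \<le> vec_norm a x"
      using assms by (simp add: vec_norm_eq powr_mono2)
    then show ?thesis
      using assms by (simp add: powr_powr)
  qed
  then have "(\<Sum>i\<in>UNIV. \<bar>x $ i\<bar>) \<le> (\<Sum>i\<in>(UNIV::'n set). vec_norm a x)"
    by (intro sum_mono)
  then show ?thesis
    using norm_le_l1_cart[of x] by simp
qed

lemma vec_norm_add_le:
  fixes x y :: "real ^ 'n"
  assumes "0 < a"
  shows "vec_norm a (x + y) \<le>
    real CARD('n) powr (1 / a) * real CARD('n) * (vec_norm a x + vec_norm a y)"
proof -
  have "norm (x + y) \<le> real CARD('n) * (vec_norm a x + vec_norm a y)"
    using norm_triangle_ineq[of x y] norm_le_vec_norm[OF assms, of x] norm_le_vec_norm[OF assms, of y]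
    by (simp add: distrib_left)
  then have "real CARD('n) powr (1 / a) * norm (x + y) \<le>
      real CARD('n) powr (1 / a) * (real CARD('n) * (vec_norm a x + vec_norm a y))"
    by (rule mult_left_mono) simp
  with vec_norm_le_norm[OF assms, of "x + y"] show ?thesis
    unfolding mult.assoc by (rule order_trans)
qed

lemma measurable_vec_norm [measurable]: "vec_norm a \<in> borel_measurable borel"
proof -
  have "(\<lambda>x. vec_norm a x) = (\<lambda>x. (\<Sum>i\<in>UNIV. \<bar>x $ i\<bar> powr enn2real (ennreal a)) powr (1 / enn2real (ennreal a)))"
    by (simp add: vec_norm_def lq_norm_def)
  also have "\<dots> \<in> borel_measurable borel"
    by measurable
  finally show ?thesis .
qed

lemma lipschitz_vec_measurable:
  assumes "lipschitz_vec a g" "0 < a"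
  shows "g \<in> borel_measurable borel"
proof -
  obtain L where L: "\<And>x y. \<bar>g x - g y\<bar> \<le> L * vec_norm a (x - y)"
    using assms by (auto simp: lipschitz_vec_def)
  let ?C = "\<bar>L\<bar> * real CARD('a) powr (1 / a)"
  have "?C-lipschitz_on UNIV g"
  proof (rule lipschitz_onI)
    fix x y
    have "\<bar>g x - g y\<bar> \<le> \<bar>L\<bar> * vec_norm a (x - y)"
      using L[of x y] vec_norm_nonneg[OF assms(2), of "x - y"]
      by (meson abs_ge_self mult_right_mono order_trans)
    also have "\<dots> \<le> \<bar>L\<bar> * (real CARD('a) powr (1 / a) * norm (x - y))"
      by (intro mult_left_mono vec_norm_le_norm assms) auto
    finally show "dist (g x) (g y) \<le> ?C * dist x y"
      by (simp add: dist_norm mult.assoc)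
  qed simp
  then show ?thesis
    by (intro borel_measurable_continuous_onI lipschitz_on_continuous_on)
qed

lemma powr_add_le:
  fixes u v p :: real
  assumes "0 \<le> u" "0 \<le> v" "0 \<le> p"
  shows "(u + v) powr p \<le> 2 powr p * (u powr p + v powr p)"
proof -
  have "(u + v) powr p \<le> (2 * max u v) powr p"
    using assms by (intro powr_mono2) auto
  also have "\<dots> = 2 powr p * max u v powr p"
    using assms by (simp add: powr_mult)
  also have "max u v powr p \<le> u powr p + v powr p"
    by (auto simp: max_def)
  finally show ?thesis by simp
qed

lemma integrable_powr_dominated:
  fixes f u v :: "'w \<Rightarrow> real"
  assumes [measurable]: "f \<in> borel_measurable M"
    and u: "integrable M (\<lambda>\<omega>. u \<omega> powr p)" and v: "integrable M (\<lambda>\<omega>. v \<omega> powr p)"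
    and le: "\<And>\<omega>. 0 \<le> f \<omega>" "\<And>\<omega>. 0 \<le> u \<omega>" "\<And>\<omega>. 0 \<le> v \<omega>" "\<And>\<omega>. f \<omega> \<le> C * (u \<omega> + v \<omega>)"
    and "0 \<le> p"
  shows "integrable M (\<lambda>\<omega>. f \<omega> powr p)"
proof (rule Bochner_Integration.integrable_bound)
  show "integrable M (\<lambda>\<omega>. \<bar>C\<bar> powr p * (2 powr p * (u \<omega> powr p + v \<omega> powr p)))"
    using u v by auto
  show "AE \<omega> in M. norm (f \<omega> powr p) \<le> norm (\<bar>C\<bar> powr p * (2 powr p * (u \<omega> powr p + v \<omega> powr p)))"
  proof (rule AE_I2)
    fix \<omega>
    have "C * (u \<omega> + v \<omega>) \<le> \<bar>C\<bar> * (u \<omega> + v \<omega>)"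
      using le by (intro mult_right_mono) (auto intro: add_nonneg_nonneg)
    then have "f \<omega> powr p \<le> (\<bar>C\<bar> * (u \<omega> + v \<omega>)) powr p"
      using le(1)[of \<omega>] le(4)[of \<omega>] \<open>0 \<le> p\<close> by (intro powr_mono2) auto
    also have "\<dots> = \<bar>C\<bar> powr p * (u \<omega> + v \<omega>) powr p"
      using le(2,3)[of \<omega>] by (simp add: powr_mult)
    also have "\<dots> \<le> \<bar>C\<bar> powr p * (2 powr p * (u \<omega> powr p + v \<omega> powr p))"
      using le \<open>0 \<le> p\<close> by (intro mult_left_mono powr_add_le) auto
    finally show "norm (f \<omega> powr p) \<le> norm (\<bar>C\<bar> powr p * (2 powr p * (u \<omega> powr p + v \<omega> powr p)))"
      by simp
  qed
qed measurable

lemma rv_cdf_eq_distr: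
  assumes "X \<in> borel_measurable M"
  shows "rv_cdf M X x = measure (distr M borel X) {..x}"
  using assms by (simp add: rv_cdf_def measure_distr vimage_def Int_def conj_commute)

lemma (in prob_space) distr_eq_if_rv_cdf_eq:
  fixes X Y :: "'a \<Rightarrow> real"
  assumes "random_variable borel X" "random_variable borel Y" "rv_cdf M X = rv_cdf M Y"
  shows "distr M borel X = distr M borel Y"
  using assms
  by (intro cdf_unique real_distribution_distr) (auto simp: cdf_def fun_eq_iff rv_cdf_eq_distr)

lemma Lp_space_distr_cong:
  assumes "X \<in> Lp_space M N p" "X' \<in> borel_measurable M" "distr M borel X' = distr M borel X"
    and [measurable]: "N \<in> borel_measurable borel"
  shows "X' \<in> Lp_space M N p"
proof -
  have X: "X \<in> borel_measurable M" "integrable M (\<lambda>\<omega>. N (X \<omega>) powr p)"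
    using assms by (auto simp: Lp_space_def)
  have "(\<lambda>x. N x powr p) \<in> borel_measurable borel"
    by measurable
  then have "integrable M (\<lambda>\<omega>. N (X' \<omega>) powr p)"
    using X assms(2,3) integrable_distr_eq[of X' M borel "\<lambda>x. N x powr p"]
      integrable_distr_eq[of X M borel "\<lambda>x. N x powr p"] by simp
  then show ?thesis
    using assms by (simp add: Lp_space_def)
qed

lemma nonatomic_optimal_coupling:
  fixes M :: "'a::euclidean_space measure" and X :: "'a \<Rightarrow> 'b::euclidean_space" and V :: "'a \<Rightarrow> real"
  assumes M: "prob_space M" "sets M = sets borel" "nonatomic M"
    and meas [measurable]: "X \<in> borel_measurable M" "g \<in> borel_measurable borel"
      "V \<in> borel_measurable M"
    and "1 \<le> p"
  obtains X' V' where "X' \<in> borel_measurable M" "V' \<in> borel_measurable M"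
    "distr M borel X' = distr M borel X" "distr M borel V' = distr M borel V"
    "\<And>V1 Y1. V1 \<in> borel_measurable M \<Longrightarrow> Y1 \<in> borel_measurable M \<Longrightarrow>
      distr M borel V1 = distr M borel V \<Longrightarrow> distr M borel Y1 = distr M borel (\<lambda>\<omega>. g (X \<omega>)) \<Longrightarrow>
      (\<integral>\<^sup>+\<omega>. ennreal (\<bar>V' \<omega> - g (X' \<omega>)\<bar> powr p) \<partial>M) \<le> (\<integral>\<^sup>+\<omega>. ennreal (\<bar>V1 \<omega> - Y1 \<omega>\<bar> powr p) \<partial>M)"
proof -
  interpret prob_space M by fact
  let ?D = "distr M borel X" and ?U = "uniform_measure lborel {0..1::real}"
  interpret D: prob_space ?D by (rule prob_space_distr) measurable
  interpret U: prob_space ?U by (rule prob_space_uniform_measure) auto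
  interpret DU: pair_prob_space ?D ?U ..
  have sets_DU: "sets (?D \<Otimes>\<^sub>M ?U) = sets borel"
    by (simp add: borel_prod[symmetric] cong: sets_pair_measure_cong)
  obtain W where W: "W \<in> borel_measurable M" and W_distr: "distr M borel W = ?D \<Otimes>\<^sub>M ?U"
    using nonatomic_realise_law[OF M DU.prob_space_axioms sets_DU] .
  have [measurable]: "W \<in> M \<rightarrow>\<^sub>M borel \<Otimes>\<^sub>M borel"
    using W by (simp add: borel_prod)
  have rect: "prob {\<omega>\<in>space M. fst (W \<omega>) \<in> A \<and> snd (W \<omega>) \<in> B} = measure ?D A * measure ?U B"
    if "A \<in> sets borel" "B \<in> sets borel" for A B
  proof -
    have "A \<times> B \<in> sets borel"
      using that by (auto simp: borel_prod[symmetric])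
    then have "prob {\<omega>\<in>space M. fst (W \<omega>) \<in> A \<and> snd (W \<omega>) \<in> B} = measure (distr M borel W) (A \<times> B)"
      using W by (simp add: measure_distr vimage_def Int_def conj_commute mem_Times_iff)
    also have "\<dots> = measure ?D A * measure ?U B"
      unfolding W_distr using that
      by (simp add: measure_def U.emeasure_pair_measure_Times enn2real_mult)
    finally show ?thesis .
  qed
  define X' where "X' \<omega> = fst (W \<omega>)" for \<omega>
  define \<Lambda> where "\<Lambda> \<omega> = max 0 (min 1 (snd (W \<omega>)))" for \<omega>
  have X'[measurable]: "X' \<in> borel_measurable M" and [measurable]: "\<Lambda> \<in> borel_measurable M"
    unfolding X'_def \<Lambda>_def by measurable
  have X'_distr: "distr M borel X' = ?D"
  proof (rule measure_eqI)
    fix A assume "A \<in> sets (distr M borel X')"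
    then show "emeasure (distr M borel X') A = emeasure ?D A"
      using rect[of A UNIV] U.prob_space
      by (simp add: emeasure_distr emeasure_eq_measure D.emeasure_eq_measure X'_def vimage_def Int_def
          conj_commute)
  qed simp
  have ind: "prob {\<omega>\<in>space M. g (X' \<omega>) = y \<and> \<Lambda> \<omega> \<le> l} = prob {\<omega>\<in>space M. g (X' \<omega>) = y} * l"
    if l: "0 \<le> l" "l \<le> 1" for y l
  proof (cases "l = 1")
    case True
    then show ?thesis by (simp add: \<Lambda>_def)
  next
    case False
    have A: "{x. g x = y} \<in> sets borel"
      by measurable
    have "measure ?U {..l} = l"
    proof -
      have "{0..1} \<inter> {..l} = {0..l}" using l by auto
      then show ?thesis using l by (simp add: measure_def emeasure_uniform_measure divide_ennreal[of _ 1, simplified])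
    qed
    moreover have "measure ?D {x. g x = y} = prob {\<omega>\<in>space M. g (X' \<omega>) = y}"
      unfolding X'_distr[symmetric] using A
      by (simp add: measure_distr vimage_def Int_def conj_commute)
    moreover have "{\<omega>\<in>space M. g (X' \<omega>) = y \<and> \<Lambda> \<omega> \<le> l} =
        {\<omega>\<in>space M. fst (W \<omega>) \<in> {x. g x = y} \<and> snd (W \<omega>) \<in> {..l}}"
      using l False by (auto simp: X'_def \<Lambda>_def)
    ultimately show ?thesis
      using rect[OF A, of "{..l}"] by simp
  qed
  obtain T where T: "uniform_rv T" "\<And>\<omega> \<omega>'. g (X' \<omega>) < g (X' \<omega>') \<Longrightarrow> T \<omega> \<le> T \<omega>'"
    by (rule distributional_transform[of "\<lambda>\<omega>. g (X' \<omega>)" \<Lambda>]) (use ind in \<open>auto simp: \<Lambda>_def\<close>)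
  have [measurable]: "T \<in> borel_measurable M"
    using T by (simp add: uniform_rv_def)
  have "real_distribution (distr M borel V)"
    by (rule real_distribution_distr) measurable
  with T(1) obtain Q where Q [measurable]: "Q \<in> borel_measurable borel" and "mono_on {0<..<1} Q"
    and V': "distr M borel (\<lambda>\<omega>. Q (T \<omega>)) = distr M borel V"
    by (rule quantile_function)
  define E where "E = {\<omega>\<in>space M. 0 < T \<omega> \<and> T \<omega> < 1}"
  have E: "E \<in> sets M" "prob E = 1"
    using uniform_rv_AE[OF T(1)] by (auto simp: E_def prob_Collect_eq_1)
  have mono: "Q (T \<omega>) \<le> Q (T \<omega>')" if "\<omega> \<in> E" "\<omega>' \<in> E" "g (X' \<omega>) < g (X' \<omega>')" for \<omega> \<omega>'
    using \<open>mono_on {0<..<1} Q\<close> T(2)[OF that(3)] that(1,2) by (auto simp: E_def mono_on_def)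
  have Y': "distr M borel (\<lambda>\<omega>. g (X' \<omega>)) = distr M borel (\<lambda>\<omega>. g (X \<omega>))"
    using arg_cong[OF X'_distr, of "\<lambda>N. distr N borel g"] by (simp add: distr_distr comp_def)
  show ?thesis
  proof (rule that[OF X' _ X'_distr V'])
    fix V1 Y1 :: "'a \<Rightarrow> real"
    assume *: "V1 \<in> borel_measurable M" "Y1 \<in> borel_measurable M"
      "distr M borel V1 = distr M borel V" "distr M borel Y1 = distr M borel (\<lambda>\<omega>. g (X \<omega>))"
    show "(\<integral>\<^sup>+\<omega>. ennreal (\<bar>Q (T \<omega>) - g (X' \<omega>)\<bar> powr p) \<partial>M) \<le>
        (\<integral>\<^sup>+\<omega>. ennreal (\<bar>V1 \<omega> - Y1 \<omega>\<bar> powr p) \<partial>M)"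
      by (rule comonotone_optimal[of _ _ V1 Y1 E]) (use * E mono V' Y' \<open>1 \<le> p\<close> in auto)
  qed measurable
qed

subsection \<open>Wasserstein distance\<close>

lemma decomposition_shift:
  assumes "decomposition a g I gt \<beta>" and d: "\<And>i. i \<in> I \<Longrightarrow> d $ i = 0"
  shows "g (x + c *\<^sub>R d) = g x + c * (\<Sum>i\<in>-I. \<beta> i * d $ i)"
proof -
  have g: "g x = gt (restrict (\<lambda>i. x $ i) I) + (\<Sum>i\<in>-I. \<beta> i * x $ i)" for x
    using assms by (auto simp: decomposition_def)
  have "restrict (\<lambda>i. (x + c *\<^sub>R d) $ i) I = restrict (\<lambda>i. x $ i) I"
    using d by (auto simp: restrict_def)
  then show ?thesis
    unfolding g by (simp only:) (simp add: algebra_simps sum.distrib sum_distrib_left)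
qed

lemma integrable_diff_powr:
  assumes "A \<in> Lp_space M abs p" "B \<in> Lp_space M abs p" "0 \<le> p"
  shows "integrable M (\<lambda>\<omega>. \<bar>A \<omega> - B \<omega>\<bar> powr p)"
proof (rule integrable_powr_dominated)
  show "integrable M (\<lambda>\<omega>. \<bar>A \<omega>\<bar> powr p)" "integrable M (\<lambda>\<omega>. \<bar>B \<omega>\<bar> powr p)"
    "(\<lambda>\<omega>. \<bar>A \<omega> - B \<omega>\<bar>) \<in> borel_measurable M"
    using assms by (auto simp: Lp_space_def)
  show "\<bar>A \<omega> - B \<omega>\<bar> \<le> 1 * (\<bar>A \<omega>\<bar> + \<bar>B \<omega>\<bar>)" for \<omega>
    by simp
qed (use assms in auto)

lemma wasserstein_le:
  assumes "X \<in> borel_measurable M" "Y \<in> borel_measurable M"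
  shows "wasserstein M N p (rv_cdf M X) (rv_cdf M Y) \<le>
    (\<integral>\<omega>. N (X \<omega> - Y \<omega>) powr p \<partial>M) powr (1 / p)"
  unfolding wasserstein_def by (rule cInf_lower) (use assms in \<open>auto intro!: bdd_belowI[of _ 0]\<close>)

lemma (in prob_space) wasserstein_ge_optimal:
  assumes V: "V \<in> Lp_space M abs p" and Y: "Y \<in> Lp_space M abs p"
    and [measurable]: "random_variable borel V'" "random_variable borel Y'"
    and opt: "\<And>V1 Y1. random_variable borel V1 \<Longrightarrow> random_variable borel Y1 \<Longrightarrow>
      distr M borel V1 = distr M borel V \<Longrightarrow> distr M borel Y1 = distr M borel Y \<Longrightarrow>
      (\<integral>\<^sup>+\<omega>. ennreal (\<bar>V' \<omega> - Y' \<omega>\<bar> powr p) \<partial>M) \<le> (\<integral>\<^sup>+\<omega>. ennreal (\<bar>V1 \<omega> - Y1 \<omega>\<bar> powr p) \<partial>M)"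
    and "0 < p"
  shows "(\<integral>\<omega>. \<bar>V' \<omega> - Y' \<omega>\<bar> powr p \<partial>M) powr (1 / p) \<le> wasserstein M abs p (rv_cdf M V) (rv_cdf M Y)"
  unfolding wasserstein_def
proof (rule cInf_greatest)
  have [measurable]: "random_variable borel V" "random_variable borel Y"
    using V Y by (auto simp: Lp_space_def)
  then show "{(\<integral>\<omega>. \<bar>A \<omega> - B \<omega>\<bar> powr p \<partial>M) powr (1 / p) |A B.
      A \<in> borel_measurable M \<and> B \<in> borel_measurable M \<and>
      rv_cdf M A = rv_cdf M V \<and> rv_cdf M B = rv_cdf M Y} \<noteq> {}"
    by blast
  fix w assume "w \<in> {(\<integral>\<omega>. \<bar>A \<omega> - B \<omega>\<bar> powr p \<partial>M) powr (1 / p) |A B.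
      A \<in> borel_measurable M \<and> B \<in> borel_measurable M \<and>
      rv_cdf M A = rv_cdf M V \<and> rv_cdf M B = rv_cdf M Y}"
  then obtain A B where AB [measurable]: "random_variable borel A" "random_variable borel B"
    and "rv_cdf M A = rv_cdf M V" "rv_cdf M B = rv_cdf M Y"
    and w: "w = (\<integral>\<omega>. \<bar>A \<omega> - B \<omega>\<bar> powr p \<partial>M) powr (1 / p)"
    by auto
  then have distr: "distr M borel A = distr M borel V" "distr M borel B = distr M borel Y"
    by (auto intro: distr_eq_if_rv_cdf_eq)
  have "A \<in> Lp_space M abs p" "B \<in> Lp_space M abs p"
    using Lp_space_distr_cong[OF V AB(1) distr(1)] Lp_space_distr_cong[OF Y AB(2) distr(2)] by auto
  then have int: "integrable M (\<lambda>\<omega>. \<bar>A \<omega> - B \<omega>\<bar> powr p)"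
    using \<open>0 < p\<close> by (intro integrable_diff_powr) auto
  have "(\<integral>\<omega>. \<bar>V' \<omega> - Y' \<omega>\<bar> powr p \<partial>M) = enn2real (\<integral>\<^sup>+\<omega>. ennreal (\<bar>V' \<omega> - Y' \<omega>\<bar> powr p) \<partial>M)"
    by (rule integral_eq_nn_integral) auto
  also have "\<dots> \<le> enn2real (\<integral>\<^sup>+\<omega>. ennreal (\<bar>A \<omega> - B \<omega>\<bar> powr p) \<partial>M)"
    using int by (intro enn2real_mono opt AB distr) (simp add: nn_integral_eq_integral)
  also have "\<dots> = (\<integral>\<omega>. \<bar>A \<omega> - B \<omega>\<bar> powr p \<partial>M)"
    by (rule integral_eq_nn_integral[symmetric]) auto
  finally show "(\<integral>\<omega>. \<bar>V' \<omega> - Y' \<omega>\<bar> powr p \<partial>M) powr (1 / p) \<le> w"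
    unfolding w using \<open>0 < p\<close> by (intro powr_mono2) auto
qed

theorem proposition1:
  fixes M :: "(real ^ 'n) measure"
    and a p \<epsilon> :: real
    and b :: ennreal
    and g :: "real ^ 'n \<Rightarrow> real"
    and I :: "'n set"
    and gt :: "('n \<Rightarrow> real) \<Rightarrow> real"
    and \<beta> :: "'n \<Rightarrow> real"
    and X :: "real ^ 'n \<Rightarrow> real ^ 'n"
  assumes "prob_space M" and "sets M = sets borel" and "nonatomic M"
    and "a \<ge> 1" and "p \<ge> 1"
    and "1 / ennreal a + 1 / b = 1"
    and "lipschitz_vec a g"
    and "\<not> (\<exists>c. \<forall>x. g x = c)"
    and "minimal_decomposition a g I gt \<beta>"
    and "X \<in> Lp_space M (vec_norm a) p"
    and "(\<lambda>\<omega>. g (X \<omega>)) \<in> Lp_space M abs p"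
    and "\<epsilon> \<ge> 0"
  shows "subset_in_law M
           (uncertainty_set M abs p (lq_norm b (-I) \<beta> * \<epsilon>) (\<lambda>\<omega>. g (X \<omega>)))
           ((\<lambda>Z \<omega>. g (Z \<omega>)) ` uncertainty_set M (vec_norm a) p \<epsilon> X)"
proof -
  interpret prob_space M by fact
  have a: "0 < a" and p: "0 < p"
    using assms by auto
  define Y where "Y \<omega> = g (X \<omega>)" for \<omega>
  define B where "B = lq_norm b (-I) \<beta>"
  have dec: "decomposition a g I gt \<beta>"
    using assms by (simp add: minimal_decomposition_def)
  have g [measurable]: "g \<in> borel_measurable borel"
    using lipschitz_vec_measurable[OF \<open>lipschitz_vec a g\<close> a] .
  have X [measurable]: "X \<in> borel_measurable M" and Y_Lp: "Y \<in> Lp_space M abs p"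
    using assms by (auto simp: Lp_space_def Y_def[abs_def])
  have B: "0 \<le> B"
    unfolding B_def lq_norm_def by (auto intro: Max_ge)
  have "\<exists>Z \<in> uncertainty_set M (vec_norm a) p \<epsilon> X. rv_cdf M (\<lambda>\<omega>. g (Z \<omega>)) = rv_cdf M V"
    if "V \<in> uncertainty_set M abs p (B * \<epsilon>) Y" for V
  proof -
    have V_Lp: "V \<in> Lp_space M abs p" and VW: "wasserstein M abs p (rv_cdf M V) (rv_cdf M Y) \<le> B * \<epsilon>"
      using that by (auto simp: uncertainty_set_def)
    have V [measurable]: "V \<in> borel_measurable M"
      using V_Lp by (simp add: Lp_space_def)
    obtain X' V' where X' [measurable]: "X' \<in> borel_measurable M"
      and V' [measurable]: "V' \<in> borel_measurable M"
      and X'_distr: "distr M borel X' = distr M borel X"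
      and V'_distr: "distr M borel V' = distr M borel V"
      and opt: "\<And>V1 Y1. V1 \<in> borel_measurable M \<Longrightarrow> Y1 \<in> borel_measurable M \<Longrightarrow>
        distr M borel V1 = distr M borel V \<Longrightarrow> distr M borel Y1 = distr M borel (\<lambda>\<omega>. g (X \<omega>)) \<Longrightarrow>
        (\<integral>\<^sup>+\<omega>. ennreal (\<bar>V' \<omega> - g (X' \<omega>)\<bar> powr p) \<partial>M) \<le> (\<integral>\<^sup>+\<omega>. ennreal (\<bar>V1 \<omega> - Y1 \<omega>\<bar> powr p) \<partial>M)"
      by (rule nonatomic_optimal_coupling[OF assms(1-3) X g V \<open>1 \<le> p\<close>]) (rule that)
    define Y' where "Y' \<omega> = g (X' \<omega>)" for \<omega>
    have [measurable]: "Y' \<in> borel_measurable M"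
      unfolding Y'_def by measurable
    have Y'_distr: "distr M borel Y' = distr M borel Y"
      using arg_cong[OF X'_distr, of "\<lambda>N. distr N borel g"]
      by (simp add: distr_distr comp_def Y_def[abs_def] Y'_def[abs_def])
    have cdf: "rv_cdf M X' = rv_cdf M X" "rv_cdf M V' = rv_cdf M V" "rv_cdf M Y' = rv_cdf M Y"
      using X'_distr V'_distr Y'_distr Y_Lp
      by (auto simp: fun_eq_iff rv_cdf_eq_distr Lp_space_def)
    define K where "K = (\<integral>\<omega>. \<bar>V' \<omega> - Y' \<omega>\<bar> powr p \<partial>M)"
    have K0: "0 \<le> K"
      unfolding K_def by simp
    have "K powr (1 / p) \<le> wasserstein M abs p (rv_cdf M V) (rv_cdf M Y)"
      unfolding K_def
      by (rule wasserstein_ge_optimal[OF V_Lp Y_Lp]) (use opt p in \<open>auto simp: Y_def[abs_def] Y'_def\<close>)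
    with VW have K: "K powr (1 / p) \<le> B * \<epsilon>"
      by simp
    have int: "integrable M (\<lambda>\<omega>. \<bar>V' \<omega> - Y' \<omega>\<bar> powr p)"
      using p Y'_distr
      by (intro integrable_diff_powr Lp_space_distr_cong[OF V_Lp V' V'_distr]
          Lp_space_distr_cong[OF Y_Lp]) auto
    show ?thesis
    proof (cases "B = 0")
      case True
      with K have "K = 0" by simp
      then have "AE \<omega> in M. V' \<omega> = Y' \<omega>"
        unfolding K_def using int by (subst (asm) integral_nonneg_eq_0_iff_AE) auto
      then have "distr M borel V' = distr M borel Y'"
        by (intro distr_cong_AE) auto
      then have "rv_cdf M V = rv_cdf M Y"
        unfolding cdf(2,3)[symmetric] by (simp add: fun_eq_iff rv_cdf_eq_distr)
      moreover have "X \<in> uncertainty_set M (vec_norm a) p \<epsilon> X"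
        using wasserstein_le[OF X X, of "vec_norm a" p] \<open>\<epsilon> \<ge> 0\<close> assms(10)
          vec_norm_scaleR[OF a, of 0 "0 :: real ^ 'n"]
        by (simp add: uncertainty_set_def)
      ultimately show ?thesis
        by (intro bexI[of _ X]) (auto simp: Y_def[abs_def])
    next
      case False
      with B have "0 < B" by simp
      obtain d where d: "\<And>i. i \<notin> - I \<Longrightarrow> d i = 0" "(\<Sum>i\<in>-I. \<beta> i * d i) = 1"
        "(\<Sum>i\<in>-I. \<bar>d i\<bar> powr a) powr (1 / a) = 1 / B"
        unfolding B_def
        by (rule dual_direction[OF \<open>a \<ge> 1\<close> assms(6), of "-I" \<beta>])
          (use \<open>0 < B\<close> in \<open>auto simp: B_def\<close>)
      define e where "e = (\<chi> i. d i)"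
      have "(\<Sum>i\<in>UNIV. \<bar>d i\<bar> powr a) = (\<Sum>i\<in>-I. \<bar>d i\<bar> powr a)"
        using d(1) by (intro sum.mono_neutral_right) auto
      then have e: "vec_norm a e = 1 / B"
        using d(3) a by (simp add: vec_norm_eq e_def)
      define Z where "Z \<omega> = X' \<omega> + (V' \<omega> - Y' \<omega>) *\<^sub>R e" for \<omega>
      have [measurable]: "Z \<in> borel_measurable M"
        unfolding Z_def by measurable
      have gZ: "g (Z \<omega>) = V' \<omega>" for \<omega>
        using d(1,2) decomposition_shift[OF dec, of e] by (simp add: Z_def e_def Y'_def)
      have Z_X': "vec_norm a (Z \<omega> - X' \<omega>) = \<bar>V' \<omega> - Y' \<omega>\<bar> / B" for \<omega>
        by (simp add: Z_def vec_norm_scaleR[OF a] e)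
      have powr: "vec_norm a (Z \<omega> - X' \<omega>) powr p = \<bar>V' \<omega> - Y' \<omega>\<bar> powr p / B powr p" for \<omega>
        using B by (simp add: Z_X' powr_divide)
      have "integrable M (\<lambda>\<omega>. vec_norm a (Z \<omega>) powr p)"
      proof (rule integrable_powr_dominated)
        show "integrable M (\<lambda>\<omega>. vec_norm a (X' \<omega>) powr p)"
          using Lp_space_distr_cong[OF assms(10) X' X'_distr] by (simp add: Lp_space_def)
        show "integrable M (\<lambda>\<omega>. vec_norm a (Z \<omega> - X' \<omega>) powr p)"
          using int by (simp add: powr)
        show "vec_norm a (Z \<omega>) \<le> real CARD('n) powr (1 / a) * real CARD('n) *
            (vec_norm a (X' \<omega>) + vec_norm a (Z \<omega> - X' \<omega>))" for \<omega>
          using vec_norm_add_le[OF a, of "X' \<omega>" "Z \<omega> - X' \<omega>"] by simp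
      qed (use a p in \<open>auto simp: vec_norm_nonneg\<close>)
      then have "Z \<in> Lp_space M (vec_norm a) p"
        by (simp add: Lp_space_def)
      moreover have "wasserstein M (vec_norm a) p (rv_cdf M Z) (rv_cdf M X) \<le> \<epsilon>"
      proof -
        have "wasserstein M (vec_norm a) p (rv_cdf M Z) (rv_cdf M X) \<le>
            (\<integral>\<omega>. vec_norm a (Z \<omega> - X' \<omega>) powr p \<partial>M) powr (1 / p)"
          unfolding cdf(1)[symmetric] by (rule wasserstein_le) measurable
        also have "(\<integral>\<omega>. vec_norm a (Z \<omega> - X' \<omega>) powr p \<partial>M) = K / B powr p"
          by (simp add: powr K_def)
        also have "(K / B powr p) powr (1 / p) = K powr (1 / p) / B"
          using K0 B p by (simp add: powr_divide powr_powr)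
        also have "\<dots> \<le> \<epsilon>"
          using K \<open>0 < B\<close> by (simp add: divide_le_eq mult.commute)
        finally show ?thesis .
      qed
      ultimately show ?thesis
        by (intro bexI[of _ Z]) (auto simp: uncertainty_set_def gZ cdf)
    qed
  qed
  then show ?thesis
    by (force simp: subset_in_law_def B_def Y_def[abs_def] image_iff)
qed

end
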